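(* Let $X$ be a locally compact Hausdorff space, and let $A\subseteq X$ be a regular closed, $\sigma$-compact, non-compact, metrizable subset. If $\{\operatorname{Homeo}_K(X)\}_{K\in\mathscr K(X)}$ satisfies ACP, then at least one of the following holds: (i) $\operatorname{Homeo}_M(X)$ is locally compact for every compact metrizable subset $M\subseteq X$; or (ii) there is a regular closed compact $K_0\subseteq A$ such that (1) for every compact $K\subseteq A$ with $K_0\subseteq K$, the subset $\operatorname{Homeo}_{K_0}(X)$ is open in $\operatorname{Homeo}_K(X)$; and (2) for every compact $C\subseteq\overline{A\setminus K_0}$, the group $\operatorname{Homeo}_C(X)$ is discrete.
   Context: A subset is regular closed if it equals the closure of its interior. For a compact $K\subseteq X$, $\operatorname{Homeo}_K(X)$ is the group of homeomorphisms of $X$ fixing every point of $X\setminus K$, with the compact-open topology (a topological group). $\mathscr K(X)$ is the set of compact subsets of $X$ ordered by inclusion, with inclusions as bonding maps. For a directed family $\{G_\alpha\}$ of topological groups with inclusions that are closed embeddings as bonding maps and union $G$, the colimit space topology is $\mathscr T=\{U\subseteq G\mid U\cap G_\alpha\text{ open in }G_\alpha\ \forall\alpha\}$; the family satisfies ACP if $(G,\mathscr T)$ is a topological group (equivalently, $\mathscr T$ equals the finest group topology making all inclusions continuous). *)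

theory Defs
  imports "HOL-Analysis.Analysis"
begin

definition regular_closed_in :: "'a topology \<Rightarrow> 'a set \<Rightarrow> bool" where
  "regular_closed_in X A \<longleftrightarrow> X closure_of (X interior_of A) = A"

definition sigma_compact_in :: "'a topology \<Rightarrow> 'a set \<Rightarrow> bool" where
  "sigma_compact_in X A \<longleftrightarrow>
     (\<exists>\<F>. countable \<F> \<and> (\<forall>K\<in>\<F>. compactin X K) \<and> \<Union>\<F> = A)"

text \<open>Homeo_K(X): homeomorphisms of X fixing every point of X - K.  Maps are
  total functions on the type; we normalise them to be the identity outside
  the carrier topspace X.\<close>
definition Homeo :: "'a topology \<Rightarrow> 'a set \<Rightarrow> ('a \<Rightarrow> 'a) set" where
  "Homeo X K = {f. homeomorphic_map X X f \<and> (\<forall>x \<in> topspace X - K. f x = x)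
                   \<and> (\<forall>x. x \<notin> topspace X \<longrightarrow> f x = x)}"

definition compact_open :: "'a topology \<Rightarrow> ('a \<Rightarrow> 'a) topology" where
  "compact_open X = topology_generated_by
     {{f. f ` C \<subseteq> U} | C U. compactin X C \<and> openin X U}"

definition Homeo_top :: "'a topology \<Rightarrow> 'a set \<Rightarrow> ('a \<Rightarrow> 'a) topology" where
  "Homeo_top X K = subtopology (compact_open X) (Homeo X K)"

definition Homeo_c :: "'a topology \<Rightarrow> ('a \<Rightarrow> 'a) set" where
  "Homeo_c X = (\<Union>K\<in>{K. compactin X K}. Homeo X K)"

definition colim_top :: "'a topology \<Rightarrow> ('a \<Rightarrow> 'a) topology" where
  "colim_top X = topology (\<lambda>U. U \<subseteq> Homeo_c X \<and>
      (\<forall>K. compactin X K \<longrightarrow> openin (Homeo_top X K) (U \<inter> Homeo X K)))"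

definition topological_group_comp :: "('a \<Rightarrow> 'a) topology \<Rightarrow> bool" where
  "topological_group_comp T \<longleftrightarrow>
     continuous_map (prod_topology T T) T (\<lambda>(f, g). f \<circ> g) \<and>
     continuous_map T T inv"

definition ACP_Homeo :: "'a topology \<Rightarrow> bool" where
  "ACP_Homeo X \<longleftrightarrow> topological_group_comp (colim_top X)"

end

theory Submission
  imports Defs
begin

text \<open>
  The argument adapts Yamasaki's for direct limits of metrizable groups. Exhaust \<open>A\<close> by regular
  closed compact sets \<open>K n\<close>. If some \<open>Homeo X (K n)\<close> is open in all later ones, it yields (ii):
  a set \<open>C\<close> contained in the closure of \<open>A - K n\<close> meets \<open>K n\<close> in a set with empty interior, so
  \<open>Homeo X C\<close> meets the open subgroup \<open>Homeo X (K n)\<close> trivially.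

  Otherwise there are, for each \<open>n\<close>, homeomorphisms \<open>x n k\<close> outside \<open>Homeo X (K n)\<close>, supported in a
  later \<open>K m\<close> and tending to the identity as \<open>k\<close> grows. If moreover \<open>Homeo X M\<close> is not locally
  compact, then, being second countable, it contains in the closure of each basic identity
  neighbourhood \<open>V n\<close> a sequence \<open>y n k\<close> without accumulation point. The elements
  \<open>y n k \<circ> inv (x n k)\<close> other than the identity form a locally finite set in every \<open>Homeo X C\<close>,
  hence a closed set for the colimit topology. But every identity neighbourhood \<open>Z\<close> of the colimit
  contains, for some \<open>n\<close> and all large \<open>k\<close>, the element \<open>x n k\<close>, while \<open>y n k\<close> is a
  quotient of two elements of \<open>Z\<close>; so the group operations are not continuous.
\<close>

section \<open>General topology\<close>

text \<open>Regularity separates \<open>K\<close> from the complement of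
  \<open>V \<inter> U0\<close>, where \<open>U0\<close> is a relatively compact neighbourhood of
  \<open>K\<close>. The closure of the resulting \<open>U\<close> then lies in \<open>L0\<close> and
  is the compact \<open>L\<close> sought.\<close>

lemma locally_compact_Hausdorff_compact_between:
  assumes "Hausdorff_space X" "locally_compact_space X"
    and K: "compactin X K" and V: "openin X V" and "K \<subseteq> V"
  obtains U L where "openin X U" "compactin X L" "K \<subseteq> U" "U \<subseteq> L" "L \<subseteq> V"
proof -
  obtain U0 L0 where 0: "openin X U0" "compactin X L0" "K \<subseteq> U0" "U0 \<subseteq> L0"
    using assms locally_compact_space_compact_closed_compact[of X] by metis
  have "closedin X (topspace X - (V \<inter> U0))"
    using V 0 by blast
  moreover have "disjnt K (topspace X - (V \<inter> U0))"
    using \<open>K \<subseteq> V\<close> 0 by (auto simp: disjnt_iff)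
  ultimately obtain U W where UW: "openin X U" "openin X W" "K \<subseteq> U"
      "topspace X - (V \<inter> U0) \<subseteq> W" "disjnt U W"
    using regular_space_compact_closed_separation[OF _ K]
      locally_compact_Hausdorff_imp_regular_space assms by metis
  have cl: "X closure_of U \<subseteq> V \<inter> U0"
  proof -
    have "W \<inter> X closure_of U = {}"
      using UW openin_Int_closure_of_eq_empty[of X W U] by (auto simp: disjnt_def)
    then show ?thesis
      using UW closure_of_subset_topspace[of X U] by blast
  qed
  have "compactin X (X closure_of U)"
    using closed_compactin[OF 0(2)] cl 0 by auto
  then show ?thesis
    using that[of U "X closure_of U"] UW cl by (auto simp: closure_of_subset openin_subset)
qed

section \<open>Countable bases and sequences without accumulation points\<close>

text \<open>Total boundedness gives finite nets at every scale \<open>1/(n+1)\<close>; the balls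
  around them form a base because a ball of radius below \<open>r/2\<close> containing
  \<open>x\<close> lies in the ball of radius \<open>r\<close> around \<open>x\<close>.\<close>

lemma compact_metrizable_imp_second_countable:
  assumes "compact_space X" "metrizable_space X"
  shows "second_countable X"
proof -
  obtain M d where "Metric_space M d" and X: "X = Metric_space.mtopology M d"
    using assms(2) by (auto simp: metrizable_space_def)
  interpret Metric_space M d by fact
  have "mtotally_bounded M"
    using assms(1) compactin_imp_mtotally_bounded by (simp add: X compact_space_def)
  then have "\<exists>C. finite C \<and> C \<subseteq> M \<and> M \<subseteq> (\<Union>x\<in>C. mball x (inverse (Suc n)))" for n
    unfolding mtotally_bounded_def by simp
  then obtain C where C: "\<And>n. finite (C n)" "\<And>n. C n \<subseteq> M"
      "\<And>n. M \<subseteq> (\<Union>x\<in>C n. mball x (inverse (real (Suc n))))"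
    by metis
  define B where "B = (\<Union>n. (\<lambda>x. mball x (inverse (real (Suc n)))) ` C n)"
  have "countable B"
    unfolding B_def using C(1) by (intro countable_UN countable_image) (auto intro: countable_finite)
  moreover have "\<exists>V\<in>B. x \<in> V \<and> V \<subseteq> U" if "openin X U" "x \<in> U" for U x
  proof -
    obtain r where r: "r > 0" "mball x r \<subseteq> U" "x \<in> M"
      using \<open>openin X U\<close> \<open>x \<in> U\<close> unfolding X openin_mtopology by (meson subsetD)
    obtain n where n: "inverse (real (Suc n)) < r / 2"
      using reals_Archimedean[of "r/2"] r by auto
    obtain c where c: "c \<in> C n" "x \<in> mball c (inverse (real (Suc n)))"
      using C(3) r by blast
    have "mball c (inverse (real (Suc n))) \<subseteq> mball x r"
    proof
      fix z assume z: "z \<in> mball c (inverse (real (Suc n)))"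
      then have "d x z \<le> d x c + d c z"
        using c r by (intro triangle) auto
      also have "\<dots> < r"
        using z c n commute[of x c] by (auto simp: in_mball)
      finally show "z \<in> mball x r"
        using z r by auto
    qed
    then show ?thesis
      using c r unfolding B_def by blast
  qed
  moreover have "\<forall>V\<in>B. openin X V"
    unfolding B_def X by auto
  ultimately show ?thesis
    unfolding second_countable_def by blast
qed

text \<open>Finitely many basic sets inside \<open>U\<close> cover \<open>K\<close>, so closing a
  countable base under finite unions suffices. Such sets reduce the compact-open topology to
  countably many conditions.\<close>

lemma second_countable_base_finite_union:
  assumes "second_countable X"
  obtains \<B> where "countable \<B>" "\<And>V. V \<in> \<B> \<Longrightarrow> openin X V"
    "\<And>K U. \<lbrakk>compactin X K; openin X U; K \<subseteq> U\<rbrakk> \<Longrightarrow> \<exists>V\<in>\<B>. K \<subseteq> V \<and> V \<subseteq> U"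
proof -
  obtain \<B> where \<B>: "countable \<B>" "\<And>V. V \<in> \<B> \<Longrightarrow> openin X V"
      "\<And>U x. \<lbrakk>openin X U; x \<in> U\<rbrakk> \<Longrightarrow> \<exists>V\<in>\<B>. x \<in> V \<and> V \<subseteq> U"
    using assms unfolding second_countable_def by metis
  let ?\<B> = "Union ` {\<F>. finite \<F> \<and> \<F> \<subseteq> \<B>}"
  show thesis
  proof
    show "countable ?\<B>"
      using countable_Collect_finite_subset[OF \<B>(1)] by blast
    show "openin X V" if "V \<in> ?\<B>" for V
      using that \<B>(2) by auto
    show "\<exists>V\<in>?\<B>. K \<subseteq> V \<and> V \<subseteq> U" if "compactin X K" "openin X U" "K \<subseteq> U" for K U
    proof -
      have "\<forall>V\<in>{V\<in>\<B>. V \<subseteq> U}. openin X V" "K \<subseteq> \<Union>{V\<in>\<B>. V \<subseteq> U}"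
        using \<B>(2,3) that by blast+
      then have "\<exists>\<F>. finite \<F> \<and> \<F> \<subseteq> {V\<in>\<B>. V \<subseteq> U} \<and> K \<subseteq> \<Union>\<F>"
        by (intro compactinD[OF \<open>compactin X K\<close>]) auto
      then obtain \<F> where "finite \<F>" "\<F> \<subseteq> {V\<in>\<B>. V \<subseteq> U}" "K \<subseteq> \<Union>\<F>"
        by (elim exE conjE)
      then show ?thesis
        by (intro bexI[of _ "\<Union>\<F>"]) auto
    qed
  qed
qed

text \<open>Finite intersections of a countable subbase are countably many. Intersecting with
  \<open>topspace X\<close> handles the empty family, as \<open>\<Inter>{}\<close> is the whole
  type.\<close>

lemma second_countable_subbase:
  assumes "countable \<S>" "\<And>S. S \<in> \<S> \<Longrightarrow> openin X S"
    and base: "\<And>U x. \<lbrakk>openin X U; x \<in> U\<rbrakk> \<Longrightarrow>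
      \<exists>\<F>. finite \<F> \<and> \<F> \<subseteq> \<S> \<and> x \<in> topspace X \<inter> \<Inter>\<F> \<and> topspace X \<inter> \<Inter>\<F> \<subseteq> U"
  shows "second_countable X"
proof -
  let ?\<B> = "(\<lambda>\<F>. topspace X \<inter> \<Inter>\<F>) ` {\<F>. finite \<F> \<and> \<F> \<subseteq> \<S>}"
  have "countable ?\<B>"
    using countable_Collect_finite_subset[OF assms(1)] by blast
  moreover have "openin X (topspace X \<inter> \<Inter>\<F>)" if "finite \<F>" "\<F> \<subseteq> \<S>" for \<F>
    using that assms(2) by (cases "\<F> = {}") (auto intro!: openin_Int openin_Inter)
  then have "\<forall>V\<in>?\<B>. openin X V"
    by auto
  moreover have "\<exists>V\<in>?\<B>. x \<in> V \<and> V \<subseteq> U" if "openin X U" "x \<in> U" for U x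
  proof -
    obtain \<F> where "finite \<F>" "\<F> \<subseteq> \<S>" "x \<in> topspace X \<inter> \<Inter>\<F>" "topspace X \<inter> \<Inter>\<F> \<subseteq> U"
      using base[OF \<open>openin X U\<close> \<open>x \<in> U\<close>] by blast
    then show ?thesis
      by (intro bexI[of _ "topspace X \<inter> \<Inter>\<F>"]) auto
  qed
  ultimately show ?thesis
    unfolding second_countable_def by (intro exI[of _ ?\<B>] conjI allI impI) (assumption | elim conjE)+
qed

lemma first_countable_decreasing_base:
  assumes "first_countable X" "x \<in> topspace X"
  obtains B :: "nat \<Rightarrow> 'a set" where "\<And>n. openin X (B n)" "\<And>n. x \<in> B n" "decseq B"
    "\<And>U. \<lbrakk>openin X U; x \<in> U\<rbrakk> \<Longrightarrow> \<exists>n. B n \<subseteq> U"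
proof -
  obtain \<B> where \<B>: "countable \<B>" "\<And>V. V \<in> \<B> \<Longrightarrow> openin X V"
      "\<And>U. \<lbrakk>openin X U; x \<in> U\<rbrakk> \<Longrightarrow> \<exists>V\<in>\<B>. x \<in> V \<and> V \<subseteq> U"
    using assms unfolding first_countable_def by metis
  define \<C> where "\<C> = {V \<in> \<B>. x \<in> V}"
  have C: "countable \<C>" "\<C> \<noteq> {}"
    using \<B>(1) \<B>(3)[OF openin_topspace assms(2)] by (auto simp: \<C>_def)
  let ?B = "\<lambda>n. \<Inter>i\<le>n. from_nat_into \<C> i"
  have mem: "from_nat_into \<C> i \<in> \<C>" for i
    using C from_nat_into by blast
  show thesis
  proof
    show "openin X (?B n)" for n
      using mem \<B>(2) by (intro openin_Inter) (auto simp: \<C>_def)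
    show "x \<in> ?B n" for n
      using mem by (auto simp: \<C>_def)
    show "decseq ?B"
      by (auto simp: decseq_def)
    show "\<exists>n. ?B n \<subseteq> U" if "openin X U" "x \<in> U" for U
    proof -
      obtain V where "V \<in> \<C>" "V \<subseteq> U"
        using \<B>(3)[OF \<open>openin X U\<close> \<open>x \<in> U\<close>] by (auto simp: \<C>_def)
      moreover then obtain n where "from_nat_into \<C> n = V"
        using C from_nat_into_surj by metis
      ultimately show ?thesis
        by (intro exI[of _ n]) auto
    qed
  qed
qed

text \<open>Join the complement of \<open>C\<close> to a cover of \<open>C\<close> without finite
  subcover and extract a countable subcover of the space. Choosing \<open>y k\<close> in
  \<open>C\<close> outside its first \<open>k+1\<close> members leaves only finitely many terms in
  each member.\<close>

lemma Lindelof_noncompact_sequence: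
  assumes X: "Lindelof_space X" and C: "closedin X C" and nc: "\<not> compactin X C"
  obtains y :: "nat \<Rightarrow> 'a" where "range y \<subseteq> C"
    "\<forall>g \<in> topspace X. \<exists>W. openin X W \<and> g \<in> W \<and> finite {k. y k \<in> W}"
proof -
  have CX: "C \<subseteq> topspace X"
    using C closedin_subset by blast
  obtain \<U> where \<U>: "\<forall>U\<in>\<U>. openin X U" "C \<subseteq> \<Union>\<U>" "\<And>\<F>. finite \<F> \<Longrightarrow> \<F> \<subseteq> \<U> \<Longrightarrow> \<not> C \<subseteq> \<Union>\<F>"
    using nc CX unfolding compactin_def by (smt (verit))
  have "\<And>U. U \<in> insert (topspace X - C) \<U> \<Longrightarrow> openin X U"
       "\<Union>(insert (topspace X - C) \<U>) = topspace X"
    using \<U>(1,2) C openin_subset by fastforce+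
  then obtain \<V> where \<V>: "countable \<V>" "\<V> \<subseteq> insert (topspace X - C) \<U>" "\<Union>\<V> = topspace X"
    using Lindelof_spaceD[OF X, of "insert (topspace X - C) \<U>"] by auto
  have ne: "\<V> \<noteq> {}"
    using \<V>(3) CX \<U>(3)[of "{}"] by auto
  let ?V = "from_nat_into \<V>"
  have mem: "?V i \<in> \<V>" for i
    using from_nat_into[OF ne] .
  have "\<exists>y. y \<in> C \<and> (\<forall>i\<le>k. y \<notin> ?V i)" for k
  proof -
    \<comment> \<open>The complement of \<open>C\<close> is dropped so that the remaining sets
      belong to \<open>\<U>\<close>; points of \<open>C\<close> avoid it anyway.\<close>
    have "\<not> C \<subseteq> \<Union>(?V ` {..k} - {topspace X - C})"
      using \<V>(2) mem by (intro \<U>(3)) auto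
    then obtain y where "y \<in> C" "y \<notin> \<Union>(?V ` {..k} - {topspace X - C})"
      by blast
    then show ?thesis
      by (intro exI[of _ y]) auto
  qed
  then obtain y where y: "\<And>k. y k \<in> C" "\<And>k i. i \<le> k \<Longrightarrow> y k \<notin> ?V i"
    by metis
  show thesis
  proof
    show "range y \<subseteq> C"
      using y by auto
    show "\<forall>g \<in> topspace X. \<exists>W. openin X W \<and> g \<in> W \<and> finite {k. y k \<in> W}"
    proof
      fix g assume "g \<in> topspace X"
      then obtain W where W: "W \<in> \<V>" "g \<in> W"
        using \<V>(3) by blast
      then obtain i where i: "?V i = W"
        using \<V>(1) from_nat_into_surj by metis
      have "{k. y k \<in> W} \<subseteq> {..<i}"
        using y(2) i by (force simp: not_less[symmetric])
      then have "finite {k. y k \<in> W}"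
        using finite_subset by blast
      moreover have "openin X W"
        using W \<V>(2) \<U>(1) C by auto
      ultimately show "\<exists>W. openin X W \<and> g \<in> W \<and> finite {k. y k \<in> W}"
        using W by blast
    qed
  qed
qed

section \<open>The groups of homeomorphisms with compact support\<close>

lemma id_in_Homeo: "id \<in> Homeo X K"
  by (simp add: Homeo_def homeomorphic_map_id)

lemma Homeo_mono: "K \<subseteq> L \<Longrightarrow> Homeo X K \<subseteq> Homeo X L"
  by (auto simp: Homeo_def)

lemma Homeo_comp:
  assumes "f \<in> Homeo X K" "g \<in> Homeo X K" shows "f \<circ> g \<in> Homeo X K"
  using assms homeomorphic_map_compose[of X X g X f] unfolding Homeo_def by auto

lemma Homeo_continuous: "f \<in> Homeo X K \<Longrightarrow> continuous_map X X f"
  by (simp add: Homeo_def homeomorphic_imp_continuous_map)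

text \<open>The convention that members are the identity off \<open>topspace X\<close> makes them
  bijections of the whole type, so that \<open>inv\<close> is a genuine inverse.\<close>

lemma Homeo_bij:
  assumes "f \<in> Homeo X K" shows "bij f"
proof -
  have h: "homeomorphic_map X X f" and out: "\<And>x. x \<notin> topspace X \<Longrightarrow> f x = x"
    using assms by (auto simp: Homeo_def)
  have "bij_betw f (topspace X) (topspace X)"
    using h homeomorphic_imp_injective_map homeomorphic_imp_surjective_map
    by (metis bij_betw_def)
  moreover have "bij_betw f (- topspace X) (- topspace X)"
    using out bij_betw_cong[of "- topspace X" f id] by (auto simp: bij_betw_def inj_on_def)
  ultimately have "bij_betw f (topspace X \<union> - topspace X) (topspace X \<union> - topspace X)"
    by (intro bij_betw_combine) auto
  then show ?thesis
    by simp
qed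

lemma Homeo_inv:
  assumes f: "f \<in> Homeo X K" shows "inv f \<in> Homeo X K"
proof -
  have b: "bij f"
    using f by (rule Homeo_bij)
  have h: "homeomorphic_map X X f" and fix_out: "\<And>x. x \<in> topspace X - K \<Longrightarrow> f x = x"
    and out: "\<And>x. x \<notin> topspace X \<Longrightarrow> f x = x"
    using f by (auto simp: Homeo_def)
  obtain g where g: "homeomorphic_maps X X f g"
    using h homeomorphic_map_maps by blast
  then have "homeomorphic_map X X g" "\<And>x. x \<in> topspace X \<Longrightarrow> f (g x) = x"
    by (auto simp: homeomorphic_maps_map)
  then have "homeomorphic_map X X (inv f)"
    using homeomorphic_map_eq[of X X g "inv f"] b by (metis bij_inv_eq_iff)
  moreover have "inv f x = x" if "f x = x" for x
    using b that by (metis bij_inv_eq_iff)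
  ultimately show ?thesis
    using fix_out out unfolding Homeo_def by blast
qed

lemma Homeo_inv_simps:
  assumes "f \<in> Homeo X K"
  shows "f \<circ> inv f = id" "inv f \<circ> f = id"
  using Homeo_bij[OF assms] by (simp_all add: bij_is_surj bij_is_inj flip: surj_iff inj_iff)

text \<open>A point of \<open>K\<close> sent outside \<open>K\<close> would have an image fixed by
  \<open>f\<close>, against injectivity.\<close>

lemma Homeo_image_subset:
  assumes f: "f \<in> Homeo X K" shows "f ` K \<subseteq> K"
proof clarify
  fix x assume "x \<in> K"
  show "f x \<in> K"
  proof (rule ccontr)
    assume "f x \<notin> K"
    then have "f (f x) = f x"
      using f by (auto simp: Homeo_def)
    then show False
      using Homeo_bij[OF f] \<open>x \<in> K\<close> \<open>f x \<notin> K\<close> by (metis bij_pointE)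
  qed
qed

lemma Homeo_Int:
  "Homeo X K \<inter> Homeo X L = Homeo X (K \<inter> L)"
  by (auto simp: Homeo_def)

section \<open>The compact-open topology: separation and closed subgroups\<close>

lemma topspace_compact_open [simp]: "topspace (compact_open X) = UNIV"
proof -
  \<comment> \<open>Mapping the empty compact set into the empty open set is no condition, so the
    subbase covers every function.\<close>
  have "UNIV = {f :: 'a \<Rightarrow> 'a. f ` {} \<subseteq> {}}" by auto
  then have "UNIV \<in> {{f :: 'a \<Rightarrow> 'a. f ` C \<subseteq> U} | C U. compactin X C \<and> openin X U}"
    using compactin_empty[of X] openin_empty[of X] by blast
  then show ?thesis
    unfolding compact_open_def topology_generated_by_topspace by blast
qed

lemma topspace_Homeo_top [simp]: "topspace (Homeo_top X K) = Homeo X K"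
  by (simp add: Homeo_top_def)

lemma openin_compact_open:
  "\<lbrakk>compactin X C; openin X U\<rbrakk> \<Longrightarrow> openin (compact_open X) {f. f ` C \<subseteq> U}"
  unfolding compact_open_def by (rule topology_generated_by_Basis) blast

lemma openin_Homeo_top:
  "\<lbrakk>compactin X C; openin X U\<rbrakk> \<Longrightarrow> openin (Homeo_top X K) {f \<in> Homeo X K. f ` C \<subseteq> U}"
  using openin_compact_open[of X C U] unfolding Homeo_top_def openin_subtopology by auto

lemma openin_Homeo_top_eval:
  "\<lbrakk>p \<in> topspace X; openin X U\<rbrakk> \<Longrightarrow> openin (Homeo_top X K) {f \<in> Homeo X K. f p \<in> U}"
  using openin_Homeo_top[of X "{p}" U K] by simp

lemma Homeo_top_subspace:
  "K \<subseteq> L \<Longrightarrow> Homeo_top X K = subtopology (Homeo_top X L) (Homeo X K)"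
  using Homeo_mono[of K L X] by (simp add: Homeo_top_def subtopology_subtopology inf.absorb2)

lemma openin_Homeo_top_Int:
  "\<lbrakk>openin (Homeo_top X L) U; K \<subseteq> L\<rbrakk> \<Longrightarrow> openin (Homeo_top X K) (U \<inter> Homeo X K)"
  by (auto simp: Homeo_top_subspace openin_subtopology)

lemma t1_space_Homeo_top:
  assumes "Hausdorff_space X" shows "t1_space (Homeo_top X K)"
  unfolding t1_space_def
proof (intro strip)
  fix f g assume fg: "f \<in> topspace (Homeo_top X K)" "g \<in> topspace (Homeo_top X K)" "f \<noteq> g"
  then obtain p where p: "f p \<noteq> g p" "p \<in> topspace X"
    by (auto simp: Homeo_def fun_eq_iff) metis
  have cl: "openin X (topspace X - {g p})"
    using assms Hausdorff_imp_t1_space[of X] t1_space_openin_delete_alt[of X] by blast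
  have "f p \<in> topspace X"
    using fg p Homeo_continuous[of f X K] by (auto simp: continuous_map_def)
  then show "\<exists>U. openin (Homeo_top X K) U \<and> f \<in> U \<and> g \<notin> U"
    using openin_Homeo_top_eval[OF p(2) cl, of K] fg p
    by (intro exI[of _ "{f \<in> Homeo X K. f p \<in> topspace X - {g p}}"]) auto
qed

text \<open>A homeomorphism outside \<open>Homeo X K\<close> moves some carrier point
  \<open>p\<close> outside \<open>K\<close>, and moving \<open>p\<close> is an open
  condition.\<close>

lemma closedin_Homeo:
  assumes "Hausdorff_space X" "K \<subseteq> L" shows "closedin (Homeo_top X L) (Homeo X K)"
  unfolding closedin_def
proof (intro conjI)
  show "Homeo X K \<subseteq> topspace (Homeo_top X L)"
    using Homeo_mono assms by auto
  show "openin (Homeo_top X L) (topspace (Homeo_top X L) - Homeo X K)"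
    unfolding openin_subopen[of _ "_ - _"]
  proof (intro ballI)
    fix g assume g: "g \<in> topspace (Homeo_top X L) - Homeo X K"
    then obtain p where p: "p \<in> topspace X - K" "g p \<noteq> p"
      by (auto simp: Homeo_def)
    have cl: "openin X (topspace X - {p})"
      using assms Hausdorff_imp_t1_space[of X] t1_space_openin_delete_alt[of X] by blast
    have "g p \<in> topspace X"
      using g p Homeo_continuous[of g X L] by (auto simp: continuous_map_def)
    then show "\<exists>T. openin (Homeo_top X L) T \<and> g \<in> T \<and> T \<subseteq> topspace (Homeo_top X L) - Homeo X K"
      using g p openin_Homeo_top_eval[OF _ cl, of p L]
      by (intro exI[of _ "{f \<in> Homeo X L. f p \<in> topspace X - {p}}"]) (auto simp: Homeo_def)
  qed
qed

section \<open>Continuity of composition, translations and second countability\<close>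

text \<open>Local compactness puts a compact neighbourhood \<open>L\<close> of the image of
  \<open>C\<close> under \<open>g\<close> inside the preimage of \<open>U\<close> under
  \<open>f\<close>. Maps sending \<open>C\<close> into \<open>V\<close>, which lies in
  \<open>L\<close>, followed by maps sending \<open>L\<close> into \<open>U\<close>, send
  \<open>C\<close> into \<open>U\<close>.\<close>

lemma continuous_map_Homeo_comp:
  assumes X: "Hausdorff_space X" "locally_compact_space X"
  shows "continuous_map (prod_topology (Homeo_top X K) (Homeo_top X K)) (Homeo_top X K) (\<lambda>(f, g). f \<circ> g)"
proof -
  let ?T = "prod_topology (Homeo_top X K) (Homeo_top X K)"
  let ?S = "{{f :: 'a \<Rightarrow> 'a. f ` C \<subseteq> U} | C U. compactin X C \<and> openin X U}"
  have "continuous_map ?T (topology_generated_by ?S) (\<lambda>(f, g). f \<circ> g)"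
  proof (rule continuous_on_generated_topo)
    fix W assume "W \<in> ?S"
    then obtain C U where W: "W = {f. f ` C \<subseteq> U}" and C: "compactin X C" and U: "openin X U"
      by auto
    show "openin ?T ((\<lambda>(f, g). f \<circ> g) -` W \<inter> topspace ?T)"
      unfolding openin_prod_topology_alt
    proof (intro allI impI)
      fix f g assume "(f, g) \<in> (\<lambda>(f, g). f \<circ> g) -` W \<inter> topspace ?T"
      then have f: "f \<in> Homeo X K" and g: "g \<in> Homeo X K" and fg: "f ` g ` C \<subseteq> U"
        by (auto simp: W)
      have gC: "compactin X (g ` C)"
        using image_compactin[OF C Homeo_continuous[OF g]] .
      have "openin X {x \<in> topspace X. f x \<in> U}"
        using openin_continuous_map_preimage[OF Homeo_continuous[OF f] U] .
      moreover have "g ` C \<subseteq> {x \<in> topspace X. f x \<in> U}"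
        using fg compactin_subset_topspace[OF gC] by auto
      ultimately obtain V L where VL: "openin X V" "compactin X L" "g ` C \<subseteq> V" "V \<subseteq> L"
          "L \<subseteq> {x \<in> topspace X. f x \<in> U}"
        by (rule locally_compact_Hausdorff_compact_between[OF X gC])
      show "\<exists>P Q. openin (Homeo_top X K) P \<and> openin (Homeo_top X K) Q \<and> f \<in> P \<and> g \<in> Q \<and>
          P \<times> Q \<subseteq> (\<lambda>(f, g). f \<circ> g) -` W \<inter> topspace ?T"
      proof (intro exI conjI)
        show "openin (Homeo_top X K) {f \<in> Homeo X K. f ` L \<subseteq> U}"
          "openin (Homeo_top X K) {g \<in> Homeo X K. g ` C \<subseteq> V}"
          using VL U C by (auto intro: openin_Homeo_top)
        show "f \<in> {f \<in> Homeo X K. f ` L \<subseteq> U}" "g \<in> {g \<in> Homeo X K. g ` C \<subseteq> V}"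
          using f g VL by auto
        have "p (q c) \<in> U" if "p ` L \<subseteq> U" "q ` C \<subseteq> V" "c \<in> C" for p q c
          using VL(4) that by blast
        then show "{f \<in> Homeo X K. f ` L \<subseteq> U} \<times> {g \<in> Homeo X K. g ` C \<subseteq> V}
            \<subseteq> (\<lambda>(f, g). f \<circ> g) -` W \<inter> topspace ?T"
          by (auto simp: W)
      qed
    qed
  next
    show "(\<lambda>(f, g). f \<circ> g) ` topspace ?T \<subseteq> \<Union> ?S"
      using topspace_compact_open[of X] unfolding compact_open_def topology_generated_by_topspace by simp
  qed
  then show ?thesis
    unfolding Homeo_top_def[of X K] compact_open_def
    by (rule continuous_map_into_subtopology)
       (auto simp: Homeo_comp Homeo_top_def[symmetric] compact_open_def[symmetric])
qed

lemma continuous_map_Homeo_left: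
  assumes X: "Hausdorff_space X" "locally_compact_space X" and f: "f \<in> Homeo X K"
  shows "continuous_map (Homeo_top X K) (Homeo_top X K) (\<lambda>g. f \<circ> g)"
proof -
  have "continuous_map (Homeo_top X K) (prod_topology (Homeo_top X K) (Homeo_top X K)) (\<lambda>g. (f, g))"
    using f by (intro continuous_map_pairedI) auto
  from continuous_map_compose[OF this continuous_map_Homeo_comp[OF X]] show ?thesis
    by (simp add: o_def)
qed

lemma openin_Homeo_translate:
  assumes X: "Hausdorff_space X" "locally_compact_space X" and f: "f \<in> Homeo X K"
    and U: "openin (Homeo_top X K) U"
  shows "openin (Homeo_top X K) ((\<lambda>g. f \<circ> g) ` U)"
proof -
  \<comment> \<open>The translate is a preimage under the continuous translation by
    \<open>inv f\<close>.\<close>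
  have "(\<lambda>g. f \<circ> g) ` U = {g \<in> topspace (Homeo_top X K). inv f \<circ> g \<in> U}"
  proof (intro equalityI subsetI)
    fix h assume "h \<in> (\<lambda>g. f \<circ> g) ` U"
    then obtain g where g: "g \<in> U" "h = f \<circ> g" by auto
    have "g \<in> Homeo X K"
      using openin_subset[OF U] g by auto
    then show "h \<in> {g \<in> topspace (Homeo_top X K). inv f \<circ> g \<in> U}"
      using g f Homeo_comp[OF f] Homeo_inv_simps(2)[OF f] by (simp add: o_assoc)
  next
    fix h assume h: "h \<in> {g \<in> topspace (Homeo_top X K). inv f \<circ> g \<in> U}"
    then show "h \<in> (\<lambda>g. f \<circ> g) ` U"
      using Homeo_inv_simps(1)[OF f] by (intro image_eqI[of _ _ "inv f \<circ> h"]) (auto simp: o_assoc)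
  qed
  then show ?thesis
    using openin_continuous_map_preimage[OF continuous_map_Homeo_left[OF X Homeo_inv[OF f]] U] by simp
qed

text \<open>A countable subbase is given by the sets of maps sending the closure of \<open>V\<close> into \<open>W\<close>, where
  \<open>V\<close> and \<open>W\<close> are finite unions of members of a countable base of \<open>M\<close>; a compact set \<open>C\<close> not
  contained in \<open>M\<close> imposes no further condition, since all maps agree off \<open>M\<close>.\<close>

lemma second_countable_Homeo_top:
  assumes X: "Hausdorff_space X" and M: "compactin X M" "metrizable_space (subtopology X M)"
  shows "second_countable (Homeo_top X M)"
proof -
  let ?T = "subtopology X M"
  have M_sub: "M \<subseteq> topspace X"
    using compactin_subset_topspace M(1) by blast
  have T: "compact_space ?T" "Hausdorff_space ?T" "locally_compact_space ?T" "closedin X M"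
    using X M by (simp_all add: compact_space_subtopology Hausdorff_space_subtopology
        compact_imp_locally_compact_space compactin_imp_closedin)
  obtain \<B> where \<B>: "countable \<B>" "\<And>V. V \<in> \<B> \<Longrightarrow> openin ?T V"
      "\<And>K U. \<lbrakk>compactin ?T K; openin ?T U; K \<subseteq> U\<rbrakk> \<Longrightarrow> \<exists>V\<in>\<B>. K \<subseteq> V \<and> V \<subseteq> U"
    using second_countable_base_finite_union compact_metrizable_imp_second_countable[OF T(1) M(2)]
    by metis
  define S where "S V W = {f \<in> Homeo X M. f ` (?T closure_of V) \<subseteq> W}" for V W
  let ?\<S> = "(\<lambda>(V, W). S V W) ` (\<B> \<times> \<B>)"
  \<comment> \<open>\<open>W\<close> is open only in \<open>M\<close>; it is the trace of an open
    \<open>W'\<close> of \<open>X\<close>, and both targets impose the same condition because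
    members of \<open>Homeo X M\<close> map \<open>M\<close> into itself.\<close>
  have open_S: "openin (Homeo_top X M) (S V W)" if "W \<in> \<B>" for V W
  proof -
    obtain W' where W': "openin X W'" "W = W' \<inter> M"
      using \<B>(2)[OF \<open>W \<in> \<B>\<close>] by (auto simp: openin_subtopology)
    have cl: "?T closure_of V \<subseteq> M"
      using closure_of_subset_topspace[of ?T V] by simp
    have "compactin X (?T closure_of V)"
      using closedin_compact_space[OF T(1) closedin_closure_of] by (simp add: compactin_subtopology)
    moreover have "S V W = {f \<in> Homeo X M. f ` (?T closure_of V) \<subseteq> W'}"
      using Homeo_image_subset[of _ X M] cl unfolding S_def W'(2) by blast
    ultimately show ?thesis
      using openin_Homeo_top W' by metis
  qed
  have basic: "\<exists>V\<in>\<B>. \<exists>W\<in>\<B>. f \<in> S V W \<and> S V W \<subseteq> {f. f ` C \<subseteq> U}"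
    if C: "compactin X C" and U: "openin X U" and f: "f \<in> Homeo X M" "f ` C \<subseteq> U" for f C U
  proof -
    have fT: "continuous_map ?T ?T f"
      using Homeo_continuous[OF f(1)] Homeo_image_subset[OF f(1)] M_sub
      by (auto simp: continuous_map_in_subtopology continuous_map_from_subtopology)
    have CM: "compactin ?T (C \<inter> M)"
      using compact_Int_closedin[OF C T(4)] by (simp add: compactin_subtopology)
    have "compactin ?T (f ` (C \<inter> M))"
      using image_compactin[OF CM fT] .
    moreover have "f ` (C \<inter> M) \<subseteq> U \<inter> M"
      using f Homeo_image_subset[OF f(1)] by auto
    ultimately obtain W where W: "W \<in> \<B>" "f ` (C \<inter> M) \<subseteq> W" "W \<subseteq> U \<inter> M"
      using \<B>(3)[of "f ` (C \<inter> M)" "U \<inter> M"] U by (auto simp: openin_subtopology_Int)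
    have "openin ?T {x \<in> topspace ?T. f x \<in> W}"
      using openin_continuous_map_preimage[OF fT \<B>(2)[OF W(1)]] .
    moreover have "C \<inter> M \<subseteq> {x \<in> topspace ?T. f x \<in> W}"
      using W(2) M_sub by auto
    ultimately obtain V' L where V': "openin ?T V'" "compactin ?T L" "C \<inter> M \<subseteq> V'" "V' \<subseteq> L"
        "L \<subseteq> {x \<in> topspace ?T. f x \<in> W}"
      by (rule locally_compact_Hausdorff_compact_between[OF T(2,3) CM])
    obtain V where V: "V \<in> \<B>" "C \<inter> M \<subseteq> V" "V \<subseteq> V'"
      using \<B>(3)[OF CM V'(1,3)] by blast
    \<comment> \<open>The compact \<open>L\<close> is closed in \<open>M\<close>, so the closure of
      \<open>V\<close> stays within the preimage of \<open>W\<close>.\<close>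
    have "?T closure_of V \<subseteq> L"
      using V V' T(2) by (intro closure_of_minimal compactin_imp_closedin) auto
    then have "f \<in> S V W"
      using f V' by (auto simp: S_def)
    moreover have "g ` C \<subseteq> U" if "g \<in> S V W" for g
    proof clarify
      fix c assume c: "c \<in> C"
      show "g c \<in> U"
      proof (cases "c \<in> M")
        case True
        then have "c \<in> ?T closure_of V"
          using c V closure_of_subset[OF openin_subset[OF \<B>(2)[OF V(1)]]] by blast
        then show ?thesis
          using that W by (auto simp: S_def)
      next
        case False
        then have "g c = f c"
          using c that f C compactin_subset_topspace[OF C] by (auto simp: S_def Homeo_def)
        then show ?thesis
          using c f by auto
      qed
    qed
    ultimately show ?thesis
      using V W by blast
  qed
  \<comment> \<open>\<open>?P\<close> tests only members of \<open>Homeo X M\<close>. It survives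
    finite intersections and unions, so induction over the generated topology carries it from
    subbasic sets to all open sets.\<close>
  let ?P = "\<lambda>U. \<forall>f \<in> U \<inter> Homeo X M. \<exists>\<F>. finite \<F> \<and> \<F> \<subseteq> ?\<S> \<and> f \<in> \<Inter>\<F> \<and> Homeo X M \<inter> \<Inter>\<F> \<subseteq> U"
  have P: "?P U" if "openin (compact_open X) U" for U
    using that unfolding compact_open_def openin_topology_generated_by_iff
  proof (induction rule: generate_topology_on.induct)
    case Empty
    then show ?case by simp
  next
    case (Int a b)
    show ?case
    proof
      fix f assume f: "f \<in> a \<inter> b \<inter> Homeo X M"
      then obtain \<F> where F: "finite \<F>" "\<F> \<subseteq> ?\<S>" "f \<in> \<Inter>\<F>" "Homeo X M \<inter> \<Inter>\<F> \<subseteq> a"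
        using bspec[OF Int.IH(1), of f] by (auto simp del: Inter_iff)
      obtain \<G> where G: "finite \<G>" "\<G> \<subseteq> ?\<S>" "f \<in> \<Inter>\<G>" "Homeo X M \<inter> \<Inter>\<G> \<subseteq> b"
        using f bspec[OF Int.IH(2), of f] by (auto simp del: Inter_iff)
      show "\<exists>\<F>. finite \<F> \<and> \<F> \<subseteq> ?\<S> \<and> f \<in> \<Inter>\<F> \<and> Homeo X M \<inter> \<Inter>\<F> \<subseteq> a \<inter> b"
      proof (intro exI conjI)
        show "finite (\<F> \<union> \<G>)" "\<F> \<union> \<G> \<subseteq> ?\<S>" "f \<in> \<Inter>(\<F> \<union> \<G>)"
          using F G by auto
        show "Homeo X M \<inter> \<Inter>(\<F> \<union> \<G>) \<subseteq> a \<inter> b"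
          using F(4) G(4) by auto
      qed
    qed
  next
    case (UN K)
    show ?case
    proof
      fix f assume "f \<in> \<Union>K \<inter> Homeo X M"
      then obtain k where k: "k \<in> K" "f \<in> k \<inter> Homeo X M"
        by auto
      then obtain \<F> where F: "finite \<F>" "\<F> \<subseteq> ?\<S>" "f \<in> \<Inter>\<F>" "Homeo X M \<inter> \<Inter>\<F> \<subseteq> k"
        using UN.IH by meson
      then show "\<exists>\<F>. finite \<F> \<and> \<F> \<subseteq> ?\<S> \<and> f \<in> \<Inter>\<F> \<and> Homeo X M \<inter> \<Inter>\<F> \<subseteq> \<Union>K"
        using k(1) by (intro exI[of _ \<F>]) auto
    qed
  next
    case (Basis s)
    then obtain C U where s: "s = {f. f ` C \<subseteq> U}" "compactin X C" "openin X U"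
      by auto
    show ?case
    proof
      fix f assume "f \<in> s \<inter> Homeo X M"
      then have "\<exists>V\<in>\<B>. \<exists>W\<in>\<B>. f \<in> S V W \<and> S V W \<subseteq> s"
        using basic[OF s(2,3), of f] by (simp add: s(1))
      then obtain V W where VW: "V \<in> \<B>" "W \<in> \<B>" "f \<in> S V W" "S V W \<subseteq> s"
        by blast
      then show "\<exists>\<F>. finite \<F> \<and> \<F> \<subseteq> ?\<S> \<and> f \<in> \<Inter>\<F> \<and> Homeo X M \<inter> \<Inter>\<F> \<subseteq> s"
        by (intro exI[of _ "{S V W}"]) auto
    qed
  qed
  show ?thesis
  proof (rule second_countable_subbase)
    show "countable ?\<S>"
      using \<B>(1) by simp
    show "openin (Homeo_top X M) R" if "R \<in> ?\<S>" for R
      using that open_S by auto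
    fix U f assume U: "openin (Homeo_top X M) U" "f \<in> U"
    obtain U' where U': "openin (compact_open X) U'" "U = U' \<inter> Homeo X M"
      using U(1) unfolding Homeo_top_def openin_subtopology by blast
    obtain \<F> where "finite \<F>" "\<F> \<subseteq> ?\<S>" "f \<in> \<Inter>\<F>" "Homeo X M \<inter> \<Inter>\<F> \<subseteq> U'"
      using P[OF U'(1)] U U' by meson
    then show "\<exists>\<F>. finite \<F> \<and> \<F> \<subseteq> ?\<S> \<and> f \<in> topspace (Homeo_top X M) \<inter> \<Inter>\<F>
        \<and> topspace (Homeo_top X M) \<inter> \<Inter>\<F> \<subseteq> U"
      using U(2) unfolding U' by (intro exI[of _ \<F>]) auto
  qed
qed

section \<open>Consequences of translation invariance\<close>

text \<open>Translates of \<open>U\<close> by elements of \<open>Homeo X K\<close> stay in that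
  subgroup and cover it.\<close>

lemma openin_Homeo_subgroupI:
  assumes X: "Hausdorff_space X" "locally_compact_space X" and KL: "K \<subseteq> L"
    and U: "openin (Homeo_top X L) U" "id \<in> U" "U \<subseteq> Homeo X K"
  shows "openin (Homeo_top X L) (Homeo X K)"
  unfolding openin_subopen[of _ "Homeo X K"]
proof
  fix f assume f: "f \<in> Homeo X K"
  then have "openin (Homeo_top X L) ((\<lambda>g. f \<circ> g) ` U)"
    using openin_Homeo_translate[OF X _ U(1)] Homeo_mono[OF KL] by blast
  moreover have "f \<in> (\<lambda>g. f \<circ> g) ` U"
    using U(2) by (intro image_eqI[of _ _ id]) auto
  moreover have "(\<lambda>g. f \<circ> g) ` U \<subseteq> Homeo X K"
    using U(3) Homeo_comp[OF f] by auto
  ultimately show "\<exists>T. openin (Homeo_top X L) T \<and> f \<in> T \<and> T \<subseteq> Homeo X K"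
    by blast
qed

text \<open>Translation carries a compact identity neighbourhood to every other point.
  Contrapositively, without local compactness no identity neighbourhood has compact closure.\<close>

lemma locally_compact_Homeo_topI:
  assumes X: "Hausdorff_space X" "locally_compact_space X"
    and U: "openin (Homeo_top X K) U" "id \<in> U" and C: "compactin (Homeo_top X K) C" "U \<subseteq> C"
  shows "locally_compact_space (Homeo_top X K)"
  unfolding locally_compact_space_def
proof
  fix f assume "f \<in> topspace (Homeo_top X K)"
  then have f: "f \<in> Homeo X K" by simp
  show "\<exists>U C. openin (Homeo_top X K) U \<and> compactin (Homeo_top X K) C \<and> f \<in> U \<and> U \<subseteq> C"
  proof (intro exI conjI)
    show "openin (Homeo_top X K) ((\<lambda>g. f \<circ> g) ` U)"
      using openin_Homeo_translate[OF X f U(1)] .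
    show "compactin (Homeo_top X K) ((\<lambda>g. f \<circ> g) ` C)"
      using image_compactin[OF C(1) continuous_map_Homeo_left[OF X f]] .
    show "f \<in> (\<lambda>g. f \<circ> g) ` U"
      using U(2) by (intro image_eqI[of _ _ id]) auto
    show "(\<lambda>g. f \<circ> g) ` U \<subseteq> (\<lambda>g. f \<circ> g) ` C"
      using C(2) by blast
  qed
qed

text \<open>The translate of \<open>V\<close> by \<open>y\<close> is a neighbourhood of
  \<open>y\<close> and so meets \<open>V\<close>; a common point \<open>y \<circ> b\<close> with
  \<open>b\<close> in \<open>V\<close> serves as \<open>a\<close>.\<close>

lemma Homeo_closure_of_quotient:
  assumes X: "Hausdorff_space X" "locally_compact_space X"
    and V: "openin (Homeo_top X K) V" "id \<in> V" and y: "y \<in> Homeo_top X K closure_of V"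
  obtains a b where "a \<in> V" "b \<in> V" "y = a \<circ> inv b"
proof -
  have yK: "y \<in> Homeo X K"
    using y closure_of_subset_topspace by fastforce
  have "y \<in> (\<lambda>g. y \<circ> g) ` V"
    using V(2) by (intro image_eqI[of _ _ id]) auto
  then have "\<exists>h. h \<in> V \<and> h \<in> (\<lambda>g. y \<circ> g) ` V"
    using y openin_Homeo_translate[OF X yK V(1)] unfolding in_closure_of by meson
  then obtain b where b: "b \<in> V" "y \<circ> b \<in> V"
    by auto
  have "b \<in> Homeo X K"
    using b openin_subset[OF V(1)] by auto
  then have "y = (y \<circ> b) \<circ> inv b"
    using Homeo_inv_simps by (metis comp_assoc comp_id)
  then show thesis
    using that b by blast
qed

section \<open>The colimit topology\<close>

text \<open>Intersecting with \<open>Homeo X K\<close> commutes with binary intersections and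
  arbitrary unions, so the predicate is a topology and the constructor \<open>topology\<close> can
  be unfolded.\<close>

lemma openin_colim_top:
  "openin (colim_top X) U \<longleftrightarrow> U \<subseteq> Homeo_c X \<and>
     (\<forall>K. compactin X K \<longrightarrow> openin (Homeo_top X K) (U \<inter> Homeo X K))"
proof -
  have "istopology (\<lambda>U. U \<subseteq> Homeo_c X \<and>
      (\<forall>K. compactin X K \<longrightarrow> openin (Homeo_top X K) (U \<inter> Homeo X K)))"
    unfolding istopology_def
  proof (rule conjI; intro allI impI)
    fix S T assume S: "S \<subseteq> Homeo_c X \<and> (\<forall>K. compactin X K \<longrightarrow> openin (Homeo_top X K) (S \<inter> Homeo X K))"
      and T: "T \<subseteq> Homeo_c X \<and> (\<forall>K. compactin X K \<longrightarrow> openin (Homeo_top X K) (T \<inter> Homeo X K))"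
    have "openin (Homeo_top X K) (S \<inter> T \<inter> Homeo X K)" if "compactin X K" for K
      using openin_Int[of "Homeo_top X K" "S \<inter> Homeo X K" "T \<inter> Homeo X K"] S T that
      by (simp add: Int_ac)
    then show "S \<inter> T \<subseteq> Homeo_c X \<and>
        (\<forall>K. compactin X K \<longrightarrow> openin (Homeo_top X K) (S \<inter> T \<inter> Homeo X K))"
      using S by blast
  next
    fix \<K> assume K: "\<forall>U\<in>\<K>. U \<subseteq> Homeo_c X \<and> (\<forall>K. compactin X K \<longrightarrow> openin (Homeo_top X K) (U \<inter> Homeo X K))"
    have "openin (Homeo_top X K) (\<Union>\<K> \<inter> Homeo X K)" if "compactin X K" for K
      using K that unfolding Int_Union2 by (intro openin_Union) auto
    then show "\<Union>\<K> \<subseteq> Homeo_c X \<and>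
        (\<forall>K. compactin X K \<longrightarrow> openin (Homeo_top X K) (\<Union>\<K> \<inter> Homeo X K))"
      using K by blast
  qed
  then show ?thesis
    unfolding colim_top_def by (simp add: topology_inverse')
qed

lemma topspace_colim_top [simp]: "topspace (colim_top X) = Homeo_c X"
proof -
  have "Homeo_c X \<inter> Homeo X K = Homeo X K" if "compactin X K" for K
    using that by (auto simp: Homeo_c_def)
  then have "openin (colim_top X) (Homeo_c X)"
    unfolding openin_colim_top
    using openin_topspace[of "Homeo_top X _"] by (simp del: openin_topspace)
  then show ?thesis
    by (metis openin_colim_top openin_subset openin_topspace subset_antisym)
qed

text \<open>Continuity of multiplication and of inversion are each applied twice. The shape of the
  product fits its use: \<open>a \<circ> inv b\<close> will be some \<open>y n k\<close> and
  \<open>c\<close> the matching \<open>x n k\<close>.\<close>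

lemma topological_group_comp_nbhd:
  assumes G: "topological_group_comp T" and U: "openin T U" "id \<in> U"
  obtains V where "openin T V" "id \<in> V" "\<And>a b c. \<lbrakk>a \<in> V; b \<in> V; c \<in> V\<rbrakk> \<Longrightarrow> a \<circ> inv b \<circ> inv c \<in> U"
proof -
  let ?m = "\<lambda>(f, g). f \<circ> g"
  have mult: "\<exists>P Q. openin T P \<and> openin T Q \<and> id \<in> P \<and> id \<in> Q \<and> (\<forall>p\<in>P. \<forall>q\<in>Q. p \<circ> q \<in> W)"
    if W: "openin T W" "id \<in> W" for W
  proof -
    have "openin (prod_topology T T) {z \<in> topspace (prod_topology T T). ?m z \<in> W}"
      using G W(1) unfolding topological_group_comp_def by (intro openin_continuous_map_preimage) auto
    moreover have "(id, id) \<in> {z \<in> topspace (prod_topology T T). ?m z \<in> W}"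
      using W openin_subset[OF W(1)] by auto
    ultimately obtain P Q where "openin T P" "openin T Q" "id \<in> P" "id \<in> Q"
        "P \<times> Q \<subseteq> {z \<in> topspace (prod_topology T T). ?m z \<in> W}"
      unfolding openin_prod_topology_alt by meson
    then show ?thesis
      by (intro exI[of _ P] exI[of _ Q]) auto
  qed
  have inverse: "openin T {x \<in> topspace T. inv x \<in> W} \<and> id \<in> {x \<in> topspace T. inv x \<in> W}"
    if W: "openin T W" "id \<in> W" for W
  proof -
    have "continuous_map T T inv"
      using G by (simp add: topological_group_comp_def)
    then show ?thesis
      using W openin_subset[OF W(1)] openin_continuous_map_preimage by (auto simp: inv_id)
  qed
  obtain P Q where PQ: "openin T P" "openin T Q" "id \<in> P" "id \<in> Q" "\<forall>p\<in>P. \<forall>q\<in>Q. p \<circ> q \<in> U"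
    using mult[OF U] by blast
  obtain P' Q' where PQ': "openin T P'" "openin T Q'" "id \<in> P'" "id \<in> Q'" "\<forall>p\<in>P'. \<forall>q\<in>Q'. p \<circ> q \<in> P"
    using mult[OF PQ(1,3)] by blast
  let ?V = "P' \<inter> {x \<in> topspace T. inv x \<in> Q'} \<inter> {x \<in> topspace T. inv x \<in> Q}"
  show thesis
  proof
    show "openin T ?V"
      using PQ PQ' inverse by (intro openin_Int) blast+
    show "id \<in> ?V"
      using inverse[OF PQ(2,4)] inverse[OF PQ'(2,4)] PQ'(3) by simp
    show "a \<circ> inv b \<circ> inv c \<in> U" if "a \<in> ?V" "b \<in> ?V" "c \<in> ?V" for a b c
      using that PQ PQ' by simp
  qed
qed

section \<open>Exhaustions and locally finite families\<close>

text \<open>Compact sets \<open>C n\<close> covering \<open>A\<close> get relatively compact open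
  neighbourhoods \<open>U n\<close>; \<open>K n\<close> closes up the part of \<open>?I\<close> in
  the first \<open>n+1\<close> of these. Closures of open sets are regular closed, and since
  \<open>A\<close> is the closure of \<open>?I\<close>, each \<open>W n\<close> meets
  \<open>A\<close> inside \<open>K n\<close>.\<close>

lemma regular_closed_compact_exhaustion:
  assumes X: "Hausdorff_space X" "locally_compact_space X"
    and A: "regular_closed_in X A" "sigma_compact_in X A"
  obtains K :: "nat \<Rightarrow> 'a set" where "incseq K" "\<And>n. regular_closed_in X (K n)"
    "\<And>n. compactin X (K n)" "\<And>n. K n \<subseteq> A"
    "\<And>C. \<lbrakk>compactin X C; C \<subseteq> A\<rbrakk> \<Longrightarrow> \<exists>n. C \<subseteq> K n"
proof -
  let ?I = "X interior_of A"
  have A_cl: "X closure_of ?I = A"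
    using A(1) by (simp add: regular_closed_in_def)
  obtain \<F> where \<F>: "countable \<F>" "\<forall>K\<in>\<F>. compactin X K" "\<Union>\<F> = A"
    using A(2) by (auto simp: sigma_compact_in_def)
  define C where "C = from_nat_into (insert {} \<F>)"
  have range_C: "range C = insert {} \<F>"
    unfolding C_def using \<F>(1) by (intro range_from_nat_into) auto
  have "compactin X (C n)" for n
    using range_C \<F>(2) by (metis compactin_empty insert_iff rangeI)
  then have "\<exists>U L. openin X U \<and> compactin X L \<and> C n \<subseteq> U \<and> U \<subseteq> L" for n
    using locally_compact_Hausdorff_compact_between[OF X _ openin_topspace]
    by (metis compactin_subset_topspace)
  then obtain U L where U: "\<And>n. openin X (U n)" and L: "\<And>n. compactin X (L n)"
    and CU: "\<And>n. C n \<subseteq> U n" and UL: "\<And>n. U n \<subseteq> L n"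
    by metis
  define W where "W n = (\<Union>i\<le>n. U i)" for n
  define K where "K n = X closure_of (W n \<inter> ?I)" for n
  have W: "openin X (W n)" for n
    unfolding W_def using U by auto
  have W_mono: "W m \<subseteq> W n" if "m \<le> n" for m n
    using that unfolding W_def by (intro UN_mono) auto
  show thesis
  proof
    show "incseq K"
      unfolding incseq_def K_def using W_mono by (auto intro!: closure_of_mono)
    show "regular_closed_in X (K n)" for n
    proof -
      have op: "openin X (W n \<inter> ?I)"
        using W by auto
      then have "W n \<inter> ?I \<subseteq> X interior_of (K n)"
        unfolding K_def by (intro interior_of_maximal) (auto simp: closure_of_subset openin_subset)
      then have "K n \<subseteq> X closure_of (X interior_of (K n))"
        unfolding K_def by (rule closure_of_mono)
      moreover have "X closure_of (X interior_of (K n)) \<subseteq> K n"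
        by (rule closure_of_minimal) (auto simp: K_def interior_of_subset)
      ultimately show ?thesis
        by (auto simp: regular_closed_in_def)
    qed
    show "compactin X (K n)" for n
    proof -
      have L': "compactin X (\<Union>i\<le>n. L i)"
        using L by (intro compactin_Union) auto
      have "W n \<inter> ?I \<subseteq> (\<Union>i\<le>n. L i)"
        unfolding W_def using UL by fastforce
      then have "K n \<subseteq> (\<Union>i\<le>n. L i)"
        unfolding K_def using compactin_imp_closedin[OF X(1) L'] by (intro closure_of_minimal)
      then show ?thesis
        using closed_compactin[OF L'] by (simp add: K_def)
    qed
    show "K n \<subseteq> A" for n
      unfolding K_def using closure_of_mono[of "W n \<inter> ?I" ?I X] A_cl by auto
    show "\<exists>n. D \<subseteq> K n" if D: "compactin X D" "D \<subseteq> A" for D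
    proof -
      have "D \<subseteq> \<Union>(range W)"
      proof
        fix x assume "x \<in> D"
        then have "x \<in> \<Union>(range C)"
          using D(2) \<F>(3) range_C by auto
        then show "x \<in> \<Union>(range W)"
          using CU unfolding W_def by blast
      qed
      then have "\<exists>\<G>. finite \<G> \<and> \<G> \<subseteq> range W \<and> D \<subseteq> \<Union>\<G>"
        using W by (intro compactinD[OF D(1)]) auto
      then obtain \<G> where "finite \<G>" "\<G> \<subseteq> range W" and DG: "D \<subseteq> \<Union>\<G>"
        by (elim exE conjE)
      then obtain J where J: "finite J" "\<G> = W ` J"
        using finite_subset_image[of \<G> W UNIV] by blast
      \<comment> \<open>As \<open>W\<close> increases, a finite subcover lies in a single member;
        the inserted \<open>0\<close> keeps \<open>Max\<close> meaningful when \<open>J\<close> is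
        empty.\<close>
      have "D \<subseteq> W (Max (insert 0 J))"
      proof
        fix x assume "x \<in> D"
        then obtain j where "j \<in> J" "x \<in> W j"
          using DG J(2) by auto
        then show "x \<in> W (Max (insert 0 J))"
          using W_mono[of j "Max (insert 0 J)"] J(1) by (simp add: subset_iff)
      qed
      then have "D \<subseteq> W (Max (insert 0 J)) \<inter> X closure_of ?I"
        using D(2) A_cl by simp
      also have "\<dots> \<subseteq> K (Max (insert 0 J))"
        unfolding K_def by (rule openin_Int_closure_of_subset[OF W])
      finally show ?thesis
        by blast
    qed
  qed
qed

section \<open>Discreteness obtained from an open stage\<close>

text \<open>The complement of \<open>K\<close> is dense and \<open>f\<close> is the identity there;
  the set where two continuous maps into a Hausdorff space agree is closed.\<close>

lemma Homeo_empty_interior: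
  assumes X: "Hausdorff_space X" and K: "X interior_of K = {}" and f: "f \<in> Homeo X K"
  shows "f = id"
proof
  fix x
  have dense: "X closure_of (topspace X - K) = topspace X"
    using K by (simp add: closure_of_complement)
  show "f x = id x"
  proof (cases "x \<in> topspace X")
    case True
    have "closedin X {z \<in> topspace X. f z = id z}"
      using closedin_continuous_maps_eq[OF X Homeo_continuous[OF f] continuous_map_id] .
    moreover have "topspace X - K \<subseteq> {z \<in> topspace X. f z = id z}"
      using f by (auto simp: Homeo_def)
    ultimately have "topspace X \<subseteq> {z \<in> topspace X. f z = id z}"
      using closure_of_minimal dense by metis
    then show ?thesis
      using True by blast
  next
    case False
    then show ?thesis
      using f by (simp add: Homeo_def)
  qed
qed

text \<open>An open set inside the closure of \<open>A - K\<close> but disjoint from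
  \<open>A - K\<close> is empty, so \<open>C \<inter> K\<close> has empty interior and
  \<open>Homeo X C\<close> meets \<open>Homeo X K\<close> only in \<open>id\<close>. Openness
  restricts to \<open>Homeo X C\<close>, where translation makes every singleton open.\<close>

lemma Homeo_discrete_off_open_subgroup:
  assumes X: "Hausdorff_space X" "locally_compact_space X"
    and op: "openin (Homeo_top X L) (Homeo X K)" and CL: "C \<subseteq> L"
    and CK: "C \<subseteq> X closure_of (A - K)"
  shows "Homeo_top X C = discrete_topology (Homeo X C)"
proof -
  have "X interior_of (C \<inter> K) = {}"
  proof -
    let ?I = "X interior_of (C \<inter> K)"
    have "?I \<subseteq> C \<inter> K"
      by (rule interior_of_subset)
    then have "?I \<inter> (A - K) = {}" "?I \<subseteq> X closure_of (A - K)"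
      using CK by auto
    then show ?thesis
      using openin_Int_closure_of_eq_empty[of X ?I "A - K"] by auto
  qed
  then have "Homeo X (C \<inter> K) = {id}"
    using Homeo_empty_interior[OF X(1), of "C \<inter> K"] id_in_Homeo[of X "C \<inter> K"] by blast
  then have "Homeo X K \<inter> Homeo X C = {id}"
    by (simp add: Homeo_Int Int_commute)
  then have one: "openin (Homeo_top X C) {id}"
    using openin_Homeo_top_Int[OF op CL] by simp
  have "openin (Homeo_top X C) {f}" if "f \<in> Homeo X C" for f
    using openin_Homeo_translate[OF X that one] by simp
  then show ?thesis
    using discrete_topology_unique[of "Homeo X C" "Homeo_top X C"] by auto
qed

section \<open>Sequences and locally finite sets when no stage is open in all later ones\<close>

text \<open>No identity neighbourhood lies in \<open>Homeo X K\<close>, as the subgroup would then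
  be open; an element outside it from each set of a decreasing base gives convergence to
  \<open>id\<close>.\<close>

lemma Homeo_not_open_sequence:
  assumes X: "Hausdorff_space X" "locally_compact_space X" and KL: "K \<subseteq> L"
    and fc: "first_countable (Homeo_top X L)"
    and nop: "\<not> openin (Homeo_top X L) (Homeo X K)"
  obtains x :: "nat \<Rightarrow> 'a \<Rightarrow> 'a" where "\<And>k. x k \<in> Homeo X L" "\<And>k. x k \<notin> Homeo X K"
    "\<And>U. \<lbrakk>openin (Homeo_top X L) U; id \<in> U\<rbrakk> \<Longrightarrow> \<forall>\<^sub>F k in sequentially. x k \<in> U"
proof -
  have "id \<in> topspace (Homeo_top X L)"
    by (simp add: id_in_Homeo)
  then obtain B :: "nat \<Rightarrow> ('a \<Rightarrow> 'a) set" where B: "\<And>n. openin (Homeo_top X L) (B n)"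
      "\<And>n. id \<in> B n" "decseq B"
      "\<And>U. \<lbrakk>openin (Homeo_top X L) U; id \<in> U\<rbrakk> \<Longrightarrow> \<exists>n. B n \<subseteq> U"
    using first_countable_decreasing_base[OF fc] by metis
  have "\<exists>x. x \<in> B k \<and> x \<notin> Homeo X K" for k
    using openin_Homeo_subgroupI[OF X KL B(1,2)] nop by blast
  then obtain x where x: "\<And>k. x k \<in> B k" "\<And>k. x k \<notin> Homeo X K"
    by metis
  show thesis
  proof
    show "x k \<in> Homeo X L" for k
      using openin_subset[OF B(1)[of k]] x(1)[of k] by auto
    show "x k \<notin> Homeo X K" for k
      by (rule x)
    fix U assume U: "openin (Homeo_top X L) U" "id \<in> U"
    obtain n where "B n \<subseteq> U"
      using B(4)[OF U] by blast
    then have "x k \<in> U" if "n \<le> k" for k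
      using decseqD[OF B(3) that] x(1) by blast
    then show "\<forall>\<^sub>F k in sequentially. x k \<in> U"
      unfolding eventually_sequentially by blast
  qed
qed

text \<open>If products of \<open>N\<close> and \<open>Q\<close> lie in \<open>W\<close> and
  \<open>x k\<close> is in \<open>Q\<close>, then \<open>y k \<circ> inv (x k)\<close> in
  \<open>N\<close> forces \<open>y k\<close> in \<open>W\<close>. Only finitely many
  \<open>x k\<close> miss \<open>Q\<close>, so local finiteness survives the perturbation.\<close>

lemma Homeo_locally_finite_perturbation:
  assumes X: "Hausdorff_space X" "locally_compact_space X" and sub: "M \<subseteq> L"
    and y: "\<And>k::nat. y k \<in> Homeo X M"
    and lf: "\<And>g. g \<in> Homeo X M \<Longrightarrow> \<exists>W. openin (Homeo_top X M) W \<and> g \<in> W \<and> finite {k. y k \<in> W}"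
    and x: "\<And>k. x k \<in> Homeo X L"
    and lim: "\<And>U. \<lbrakk>openin (Homeo_top X L) U; id \<in> U\<rbrakk> \<Longrightarrow> \<forall>\<^sub>F k in sequentially. x k \<in> U"
    and g: "g \<in> Homeo X L"
  obtains N where "openin (Homeo_top X L) N" "g \<in> N" "finite {k. y k \<circ> inv (x k) \<in> N}"
proof -
  let ?T = "Homeo_top X L"
  \<comment> \<open>Local finiteness of \<open>y\<close> is given only at points of
    \<open>Homeo X M\<close>; elsewhere, closedness of this subgroup supplies a neighbourhood free
    of all \<open>y k\<close>.\<close>
  obtain W where W: "openin ?T W" "g \<in> W" "finite {k. y k \<in> W}"
  proof (cases "g \<in> Homeo X M")
    case True
    then obtain W0 where W0: "openin (Homeo_top X M) W0" "g \<in> W0" "finite {k. y k \<in> W0}"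
      using lf by blast
    then obtain W where W: "openin ?T W" "W0 = W \<inter> Homeo X M"
      unfolding Homeo_top_subspace[OF sub] openin_subtopology by blast
    moreover have "{k. y k \<in> W} = {k. y k \<in> W0}"
      using W(2) y by auto
    ultimately show ?thesis
      using that[of W] W0 by auto
  next
    case False
    have "openin ?T (topspace ?T - Homeo X M)"
      using closedin_Homeo[OF X(1) sub] by blast
    moreover have "g \<in> topspace ?T - Homeo X M"
      using g False by simp
    moreover have "{k. y k \<in> topspace ?T - Homeo X M} = {}"
      using y by auto
    ultimately show ?thesis
      using that[of "topspace ?T - Homeo X M"] by (metis finite.emptyI)
  qed
  have "openin (prod_topology ?T ?T) {z \<in> topspace (prod_topology ?T ?T). (\<lambda>(f, g). f \<circ> g) z \<in> W}"
    using continuous_map_Homeo_comp[OF X] W(1) by (rule openin_continuous_map_preimage)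
  moreover have "(g, id) \<in> {z \<in> topspace (prod_topology ?T ?T). (\<lambda>(f, g). f \<circ> g) z \<in> W}"
    using g W(2) id_in_Homeo by auto
  ultimately obtain N Q where NQ: "openin ?T N" "openin ?T Q" "g \<in> N" "id \<in> Q"
      "N \<times> Q \<subseteq> {z \<in> topspace (prod_topology ?T ?T). (\<lambda>(f, g). f \<circ> g) z \<in> W}"
    unfolding openin_prod_topology_alt by meson
  obtain k0 where k0: "\<And>k. k0 \<le> k \<Longrightarrow> x k \<in> Q"
    using lim[OF NQ(2,4)] unfolding eventually_sequentially by blast
  have "{k. y k \<circ> inv (x k) \<in> N} \<subseteq> {..<k0} \<union> {k. y k \<in> W}"
  proof
    fix k assume k: "k \<in> {k. y k \<circ> inv (x k) \<in> N}"
    show "k \<in> {..<k0} \<union> {k. y k \<in> W}"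
    proof (cases "k < k0")
      case False
      then have "(y k \<circ> inv (x k), x k) \<in> N \<times> Q"
        using k k0 by auto
      then have "y k \<circ> inv (x k) \<circ> x k \<in> W"
        using NQ(5) by auto
      then show ?thesis
        using Homeo_inv_simps(2)[OF x[of k]] by (simp add: comp_assoc)
    qed auto
  qed
  then have "finite {k. y k \<circ> inv (x k) \<in> N}"
    using W(3) finite_subset by blast
  then show thesis
    using that NQ by blast
qed

text \<open>Every closure of a \<open>V n\<close> is noncompact, since a compact one would give
  local compactness by translation. Second countability yields both the base \<open>V\<close> and
  the Lindelof property behind the sequences \<open>y n\<close>.\<close>

lemma Homeo_not_locally_compact_sequences:
  assumes X: "Hausdorff_space X" "locally_compact_space X"
    and M: "compactin X M" "metrizable_space (subtopology X M)"
    and nlc: "\<not> locally_compact_space (Homeo_top X M)"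
  obtains V :: "nat \<Rightarrow> ('a \<Rightarrow> 'a) set" and y :: "nat \<Rightarrow> nat \<Rightarrow> 'a \<Rightarrow> 'a"
  where "\<forall>U. openin (Homeo_top X M) U \<and> id \<in> U \<longrightarrow> (\<exists>n. V n \<subseteq> U)"
    "\<forall>n k. y n k \<in> Homeo_top X M closure_of V n"
    "\<forall>n. \<forall>g \<in> Homeo X M. \<exists>W. openin (Homeo_top X M) W \<and> g \<in> W \<and> finite {k. y n k \<in> W}"
proof -
  let ?H = "Homeo_top X M"
  have sc: "second_countable ?H"
    using second_countable_Homeo_top[OF X(1) M] .
  have "id \<in> topspace ?H"
    by (simp add: id_in_Homeo)
  then obtain V :: "nat \<Rightarrow> ('a \<Rightarrow> 'a) set" where V: "\<And>n. openin ?H (V n)" "\<And>n. id \<in> V n" "decseq V"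
      "\<And>U. \<lbrakk>openin ?H U; id \<in> U\<rbrakk> \<Longrightarrow> \<exists>n. V n \<subseteq> U"
    using first_countable_decreasing_base[OF second_countable_imp_first_countable[OF sc]] by metis
  have "\<forall>n. \<exists>y :: nat \<Rightarrow> 'a \<Rightarrow> 'a. range y \<subseteq> ?H closure_of V n \<and>
      (\<forall>g \<in> Homeo X M. \<exists>W. openin ?H W \<and> g \<in> W \<and> finite {k. y k \<in> W})"
  proof
    fix n
    have "\<not> compactin ?H (?H closure_of V n)"
      using locally_compact_Homeo_topI[OF X V(1,2)] nlc closure_of_subset openin_subset V(1) by metis
    then obtain y :: "nat \<Rightarrow> 'a \<Rightarrow> 'a" where "range y \<subseteq> ?H closure_of V n"
        "\<forall>g \<in> topspace ?H. \<exists>W. openin ?H W \<and> g \<in> W \<and> finite {k. y k \<in> W}"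
      by (rule Lindelof_noncompact_sequence[OF second_countable_imp_Lindelof_space[OF sc] closedin_closure_of])
    then show "\<exists>y :: nat \<Rightarrow> 'a \<Rightarrow> 'a. range y \<subseteq> ?H closure_of V n \<and>
        (\<forall>g \<in> Homeo X M. \<exists>W. openin ?H W \<and> g \<in> W \<and> finite {k. y k \<in> W})"
      by (intro exI[of _ y]) simp
  qed
  from choice[OF this]
  obtain y :: "nat \<Rightarrow> nat \<Rightarrow> 'a \<Rightarrow> 'a" where y: "\<forall>n. range (y n) \<subseteq> ?H closure_of V n \<and>
      (\<forall>g \<in> Homeo X M. \<exists>W. openin ?H W \<and> g \<in> W \<and> finite {k. y n k \<in> W})"
    ..
  show thesis
  proof (rule that[of V y])
    show "\<forall>U. openin ?H U \<and> id \<in> U \<longrightarrow> (\<exists>n. V n \<subseteq> U)"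
      using V(4) by simp
    show "\<forall>n k. y n k \<in> ?H closure_of V n"
      using y by (meson range_subsetD)
    show "\<forall>n. \<forall>g \<in> Homeo X M. \<exists>W. openin ?H W \<and> g \<in> W \<and> finite {k. y n k \<in> W}"
      using y by simp
  qed
qed

text \<open>In each stage \<open>N \<inter> F\<close> is finite, hence closed by T1, so removing it
  from \<open>N\<close> leaves an open set.\<close>

lemma openin_colim_top_locally_finite:
  assumes X: "Hausdorff_space X"
    and lf: "\<And>C g. \<lbrakk>compactin X C; g \<in> Homeo X C\<rbrakk> \<Longrightarrow>
      \<exists>N. openin (Homeo_top X C) N \<and> g \<in> N \<and> finite (N \<inter> F)"
  shows "openin (colim_top X) (Homeo_c X - F)"
  unfolding openin_colim_top
proof (intro conjI allI impI)
  show "Homeo_c X - F \<subseteq> Homeo_c X" by blast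
  fix C assume C: "compactin X C"
  show "openin (Homeo_top X C) ((Homeo_c X - F) \<inter> Homeo X C)"
    unfolding openin_subopen[of _ "_ \<inter> _"]
  proof
    fix g assume g: "g \<in> (Homeo_c X - F) \<inter> Homeo X C"
    then obtain N where N: "openin (Homeo_top X C) N" "g \<in> N" "finite (N \<inter> F)"
      using lf[OF C] by blast
    have NC: "N \<subseteq> Homeo X C"
      using openin_subset[OF N(1)] by simp
    then have "closedin (Homeo_top X C) (N \<inter> F)"
      using t1_space_Homeo_top[OF X, of C] N(3) unfolding t1_space_closedin_finite by auto
    then have "openin (Homeo_top X C) (N - N \<inter> F)"
      using N(1) by (rule openin_diff[rotated])
    moreover have "N - N \<inter> F \<subseteq> (Homeo_c X - F) \<inter> Homeo X C"
      using NC C by (auto simp: Homeo_c_def)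
    ultimately show "\<exists>T. openin (Homeo_top X C) T \<and> g \<in> T \<and> T \<subseteq> (Homeo_c X - F) \<inter> Homeo X C"
      using N(2) g by (intro exI[of _ "N - N \<inter> F"]) auto
  qed
qed

section \<open>Failure of ACP and the resulting dichotomy\<close>

text \<open>Row \<open>n\<close> of the double array \<open>?w\<close> defeats those identity
  neighbourhoods whose trace on \<open>Homeo X M\<close> contains \<open>V n\<close>. Every identity
  neighbourhood of the colimit is of this kind for some \<open>n\<close>.\<close>

lemma not_ACP_Homeo:
  assumes X: "Hausdorff_space X" "locally_compact_space X" and A: "closedin X A"
    and M: "compactin X M" "metrizable_space (subtopology X M)"
      "\<not> locally_compact_space (Homeo_top X M)"
    and K: "incseq K" "\<And>C. \<lbrakk>compactin X C; C \<subseteq> A\<rbrakk> \<Longrightarrow> \<exists>n::nat. C \<subseteq> K n"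
    and P: "\<And>n. compactin X (P n)" "\<And>n. P n \<subseteq> A"
    and x: "\<And>n k. x n k \<in> Homeo X (P n)" "\<And>n k. x n k \<notin> Homeo X (K n)"
    and lim: "\<And>n U. \<lbrakk>openin (Homeo_top X (P n)) U; id \<in> U\<rbrakk> \<Longrightarrow> \<forall>\<^sub>F k in sequentially. x n k \<in> U"
  shows "\<not> ACP_Homeo X"
proof
  assume ACP: "ACP_Homeo X"
  let ?H = "Homeo_top X M"
  obtain V :: "nat \<Rightarrow> ('a \<Rightarrow> 'a) set" and y :: "nat \<Rightarrow> nat \<Rightarrow> 'a \<Rightarrow> 'a"
    where V: "\<forall>U. openin ?H U \<and> id \<in> U \<longrightarrow> (\<exists>n. V n \<subseteq> U)"
    and y: "\<forall>n k. y n k \<in> ?H closure_of V n"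
    and y_lf: "\<forall>n. \<forall>g \<in> Homeo X M. \<exists>W. openin ?H W \<and> g \<in> W \<and> finite {k. y n k \<in> W}"
    by (rule Homeo_not_locally_compact_sequences[OF X M])
  have yM: "y n k \<in> Homeo X M" for n k
    using spec[OF spec[OF y], of n k] closure_of_subset_topspace[of ?H "V n"] by auto
  let ?w = "\<lambda>(n, k). y n k \<circ> inv (x n k)"
  \<comment> \<open>Finiteness is counted over index pairs, not over values: this also excludes that
    infinitely many entries equal \<open>id\<close>.\<close>
  have lf: "\<exists>N. openin (Homeo_top X C) N \<and> g \<in> N \<and> finite {nk. ?w nk \<in> N}"
    if C: "compactin X C" and g: "g \<in> Homeo X C" for C g
  proof -
    have "compactin X ((C \<union> M) \<inter> A)"
      using C M(1) A by (intro compact_Int_closedin compactin_Un)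
    then obtain n0 where n0: "(C \<union> M) \<inter> A \<subseteq> K n0"
      using K(2) by blast
    \<comment> \<open>Only finitely many \<open>n\<close> matter: if \<open>y n k \<circ> inv (x n k)\<close> is supported in \<open>C\<close>, then \<open>x n k\<close> is
      supported in \<open>(C \<union> M) \<inter> A\<close>, which lies in \<open>K n0\<close>.\<close>
    have small: "n < n0" if w: "?w (n, k) \<in> Homeo X C" for n k
    proof (rule ccontr)
      assume "\<not> n < n0"
      have yx: "y n k \<circ> inv (x n k) \<in> Homeo X (C \<union> M)" "y n k \<in> Homeo X (C \<union> M)"
        using w yM[of n k] Homeo_mono[of C "C \<union> M" X] Homeo_mono[of M "C \<union> M" X] by auto
      have "x n k = inv (y n k \<circ> inv (x n k)) \<circ> y n k"
      proof -
        have "bij (x n k)" "bij (y n k)"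
          using Homeo_bij x(1) yM by blast+
        then show ?thesis
          by (simp add: o_inv_distrib bij_imp_bij_inv inv_inv_eq comp_assoc bij_is_inj)
      qed
      then have "x n k \<in> Homeo X (C \<union> M)"
        using Homeo_comp[OF Homeo_inv[OF yx(1)] yx(2)] by simp
      then have "x n k \<in> Homeo X ((C \<union> M) \<inter> P n)"
        using x(1)[of n k] Homeo_Int[of X "C \<union> M" "P n"] by blast
      moreover have "(C \<union> M) \<inter> P n \<subseteq> K n"
        using n0 P(2)[of n] incseqD[OF K(1), of n0 n] \<open>\<not> n < n0\<close> by auto
      ultimately show False
        using x(2)[of n k] Homeo_mono by blast
    qed
    have "\<exists>N. openin (Homeo_top X C) N \<and> g \<in> N \<and> finite {k. ?w (n, k) \<in> N}" for n
    proof -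
      \<comment> \<open>A stage containing \<open>g\<close> and both sequences of row
        \<open>n\<close>; the neighbourhood found there is afterwards cut down to
        \<open>Homeo X C\<close>.\<close>
      let ?L = "C \<union> M \<union> P n"
      have lim': "\<forall>\<^sub>F k in sequentially. x n k \<in> U" if U: "openin (Homeo_top X ?L) U" "id \<in> U" for U
      proof -
        have "\<forall>\<^sub>F k in sequentially. x n k \<in> U \<inter> Homeo X (P n)"
          using openin_Homeo_top_Int[OF U(1), of "P n"] U(2) id_in_Homeo by (intro lim) auto
        then show ?thesis
          by (rule eventually_mono) auto
      qed
      have x': "x n k \<in> Homeo X ?L" for k
        using x(1)[of n k] Homeo_mono[of "P n" ?L X] by auto
      have g': "g \<in> Homeo X ?L"
        using g Homeo_mono[of C ?L X] by auto
      have sub: "M \<subseteq> ?L"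
        by auto
      obtain N where N: "openin (Homeo_top X ?L) N" "g \<in> N" "finite {k. y n k \<circ> inv (x n k) \<in> N}"
        by (rule Homeo_locally_finite_perturbation
            [OF X sub yM bspec[OF spec[OF y_lf]] x' lim' g'])
      have "finite {k. ?w (n, k) \<in> N \<inter> Homeo X C}"
        using N(3) by (rule rev_finite_subset) auto
      moreover have "openin (Homeo_top X C) (N \<inter> Homeo X C)"
        using N(1) by (rule openin_Homeo_top_Int) auto
      ultimately show ?thesis
        using N(2) g by blast
    qed
    then have "\<forall>n. \<exists>N. openin (Homeo_top X C) N \<and> g \<in> N \<and> finite {k. ?w (n, k) \<in> N}"
      by (rule allI)
    from choice[OF this]
    obtain N where "\<forall>n. openin (Homeo_top X C) (N n) \<and> g \<in> N n \<and> finite {k. ?w (n, k) \<in> N n}"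
      ..
    then have N: "\<And>n. openin (Homeo_top X C) (N n)" "\<And>n. g \<in> N n"
        "\<And>n. finite {k. ?w (n, k) \<in> N n}"
      by (simp_all only:)
    \<comment> \<open>By \<open>small\<close> only rows below \<open>n0\<close> can enter
      \<open>Homeo X C\<close>; the bound \<open>n \<le> n0\<close> keeps the intersected family
      nonempty even for \<open>n0 = 0\<close>.\<close>
    let ?N = "Homeo X C \<inter> (\<Inter>n\<le>n0. N n)"
    have "openin (Homeo_top X C) ?N"
      using N(1) openin_topspace[of "Homeo_top X C"]
      by (intro openin_Int openin_Inter) (auto simp del: openin_topspace)
    moreover have "g \<in> ?N"
      using N(2) g by simp
    moreover have "{nk. ?w nk \<in> ?N} \<subseteq> (SIGMA n:{..n0}. {k. ?w (n, k) \<in> N n})"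
    proof
      fix nk assume nk: "nk \<in> {nk. ?w nk \<in> ?N}"
      obtain n k where "nk = (n, k)" by (cases nk)
      with nk small[of n k] show "nk \<in> (SIGMA n:{..n0}. {k. ?w (n, k) \<in> N n})"
        by auto
    qed
    then have "finite {nk. ?w nk \<in> ?N}"
      by (rule finite_subset) (intro finite_SigmaI finite_atMost N(3))
    ultimately show ?thesis
      by blast
  qed
  \<comment> \<open>\<open>id\<close> is removed so that the complement of \<open>F\<close> is an
    identity neighbourhood; entries equal to \<open>id\<close> are handled at the end by counting
    indices.\<close>
  define F where "F = range ?w - {id}"
  have "openin (colim_top X) (Homeo_c X - F)"
  proof (rule openin_colim_top_locally_finite[OF X(1)])
    fix C g assume "compactin X C" "g \<in> Homeo X C"
    then obtain N where N: "openin (Homeo_top X C) N" "g \<in> N" "finite {nk. ?w nk \<in> N}"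
      using lf by blast
    have "N \<inter> F \<subseteq> ?w ` {nk. ?w nk \<in> N}"
      unfolding F_def by blast
    then have "finite (N \<inter> F)"
      using N(3) finite_surj by blast
    then show "\<exists>N. openin (Homeo_top X C) N \<and> g \<in> N \<and> finite (N \<inter> F)"
      using N by blast
  qed
  moreover have "id \<in> Homeo_c X - F"
    using M(1) id_in_Homeo by (auto simp: F_def Homeo_c_def)
  ultimately obtain Z where Z: "openin (colim_top X) Z" "id \<in> Z"
      "\<And>a b c. \<lbrakk>a \<in> Z; b \<in> Z; c \<in> Z\<rbrakk> \<Longrightarrow> a \<circ> inv b \<circ> inv c \<in> Homeo_c X - F"
    using topological_group_comp_nbhd ACP unfolding ACP_Homeo_def by metis
  have ZM: "openin ?H (Z \<inter> Homeo X M)" "id \<in> Z \<inter> Homeo X M"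
    using Z(1,2) M(1) id_in_Homeo by (auto simp: openin_colim_top)
  obtain n where n: "V n \<subseteq> Z \<inter> Homeo X M"
    using V ZM by blast
  \<comment> \<open>\<open>V n\<close> lies in the trace of \<open>Z\<close>, so
    \<open>y n k\<close> is in the closure of that trace and is a quotient of two of its
    elements.\<close>
  have yZ: "\<exists>a\<in>Z. \<exists>b\<in>Z. y n k = a \<circ> inv b" for k
  proof -
    have "y n k \<in> ?H closure_of (Z \<inter> Homeo X M)"
      using y closure_of_mono[OF n] by blast
    then show ?thesis
      using Homeo_closure_of_quotient[OF X ZM] by (metis IntD1)
  qed
  have "openin (Homeo_top X (P n)) (Z \<inter> Homeo X (P n))" "id \<in> Z \<inter> Homeo X (P n)"
    using Z(1,2) P(1) id_in_Homeo by (auto simp: openin_colim_top)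
  then obtain k0 where k0: "\<And>k. k0 \<le> k \<Longrightarrow> x n k \<in> Z"
    using lim unfolding eventually_sequentially by blast
  \<comment> \<open>The choice of \<open>Z\<close> makes the product avoid \<open>F\<close>, and an
    entry of the array outside \<open>F\<close> can only be \<open>id\<close>.\<close>
  have w_id: "?w (n, k) = id" if "k0 \<le> k" for k
  proof -
    obtain a b where "a \<in> Z" "b \<in> Z" "y n k = a \<circ> inv b"
      using yZ by blast
    then have "?w (n, k) \<in> Homeo_c X - F"
      using Z(3) k0[OF that] by simp
    then show ?thesis
      unfolding F_def by blast
  qed
  \<comment> \<open>Infinitely many entries of row \<open>n\<close> equal \<open>id\<close>, against
    local finiteness at \<open>id\<close>.\<close>
  obtain N where N: "id \<in> N" "finite {nk. ?w nk \<in> N}"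
    using lf[OF M(1) id_in_Homeo] by blast
  have "Pair n ` {k0..} \<subseteq> {nk. ?w nk \<in> N}"
    using w_id N(1) by auto
  then have "finite (Pair n ` {k0..})"
    using N(2) finite_subset by blast
  then show False
    by (simp add: finite_image_iff inj_on_def infinite_Ici)
qed

theorem theorem4p1:
  fixes X :: "'a topology" and A :: "'a set"
  assumes "Hausdorff_space X" and "locally_compact_space X"
    and "regular_closed_in X A" and "sigma_compact_in X A"
    and "\<not> compactin X A" and "metrizable_space (subtopology X A)"
    and "ACP_Homeo X"
  shows "(\<forall>M. compactin X M \<and> metrizable_space (subtopology X M)
              \<longrightarrow> locally_compact_space (Homeo_top X M))
       \<or> (\<exists>K0. regular_closed_in X K0 \<and> compactin X K0 \<and> K0 \<subseteq> A \<and>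
            (\<forall>K. compactin X K \<and> K \<subseteq> A \<and> K0 \<subseteq> K
                 \<longrightarrow> openin (Homeo_top X K) (Homeo X K0)) \<and>
            (\<forall>C. compactin X C \<and> C \<subseteq> X closure_of (A - K0)
                 \<longrightarrow> Homeo_top X C = discrete_topology (Homeo X C)))"
proof (cases "\<forall>M. compactin X M \<and> metrizable_space (subtopology X M)
    \<longrightarrow> locally_compact_space (Homeo_top X M)")
  case False
  then obtain M where M: "compactin X M" "metrizable_space (subtopology X M)"
      "\<not> locally_compact_space (Homeo_top X M)"
    by blast
  note X = assms(1,2)
  have A: "closedin X A"
    using assms(3) unfolding regular_closed_in_def by (metis closedin_closure_of)
  obtain K where K: "incseq K" "\<And>n. regular_closed_in X (K n)" "\<And>n. compactin X (K n)"
      "\<And>n. K n \<subseteq> A" "\<And>C. \<lbrakk>compactin X C; C \<subseteq> A\<rbrakk> \<Longrightarrow> \<exists>n::nat. C \<subseteq> K n"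
    using regular_closed_compact_exhaustion[OF X assms(3,4)] by metis
  \<comment> \<open>Metrizability of \<open>A\<close> passes to \<open>K m\<close> and provides the
    countable identity base from which the sequences \<open>x n\<close> are drawn.\<close>
  have fc: "first_countable (Homeo_top X (K m))" for m
  proof -
    have "subtopology X (K m) = subtopology (subtopology X A) (K m)"
      using K(4)[of m] by (simp add: subtopology_subtopology inf.absorb2)
    then have "metrizable_space (subtopology X (K m))"
      using assms(6) metrizable_space_subtopology by simp
    then show ?thesis
      using second_countable_imp_first_countable second_countable_Homeo_top[OF X(1) K(3)] by blast
  qed
  \<comment> \<open>This \<open>n\<close> yields \<open>K0 = K n\<close>. Otherwise each
    \<open>n\<close> has a later \<open>m n\<close> in whose stage \<open>Homeo X (K n)\<close> is
    not open, and the resulting sequences refute ACP.\<close>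
  have "\<exists>n. \<forall>m\<ge>n. openin (Homeo_top X (K m)) (Homeo X (K n))"
  proof (rule ccontr)
    assume "\<not> ?thesis"
    then obtain m where m: "\<And>n. n \<le> m n" "\<And>n. \<not> openin (Homeo_top X (K (m n))) (Homeo X (K n))"
      by metis
    have "\<exists>x :: nat \<Rightarrow> 'a \<Rightarrow> 'a. (\<forall>k. x k \<in> Homeo X (K (m n)) \<and> x k \<notin> Homeo X (K n)) \<and>
        (\<forall>U. openin (Homeo_top X (K (m n))) U \<longrightarrow> id \<in> U \<longrightarrow> (\<forall>\<^sub>F k in sequentially. x k \<in> U))" for n
      using Homeo_not_open_sequence[OF X incseqD[OF K(1) m(1)] fc m(2)] by metis
    then obtain x where "\<And>n k::nat. x n k \<in> Homeo X (K (m n))" "\<And>n k. x n k \<notin> Homeo X (K n)"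
        "\<And>n U. \<lbrakk>openin (Homeo_top X (K (m n))) U; id \<in> U\<rbrakk> \<Longrightarrow> \<forall>\<^sub>F k in sequentially. x n k \<in> U"
      by metis
    then have "\<not> ACP_Homeo X"
      using not_ACP_Homeo[OF X A M K(1,5), of "\<lambda>n. K (m n)" x] K(3,4) by blast
    then show False
      using assms(7) by blast
  qed
  then obtain n where n: "\<And>m. n \<le> m \<Longrightarrow> openin (Homeo_top X (K m)) (Homeo X (K n))"
    by blast
  have absorb: "\<exists>m\<ge>n. C \<subseteq> K m" if C: "compactin X C" "C \<subseteq> A" for C
  proof -
    obtain m where "C \<subseteq> K m"
      using K(5)[OF C] by blast
    then show ?thesis
      using incseqD[OF K(1), of m "max m n"] by (intro exI[of _ "max m n"]) auto
  qed
  have "openin (Homeo_top X C) (Homeo X (K n))" if C: "compactin X C" "C \<subseteq> A" "K n \<subseteq> C" for C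
  proof -
    obtain m where m: "n \<le> m" "C \<subseteq> K m"
      using absorb[OF C(1,2)] by blast
    then show ?thesis
      using openin_Homeo_top_Int[OF n[OF m(1)] m(2)] Homeo_mono[OF C(3), of X] by (simp add: inf.absorb1)
  qed
  moreover have "Homeo_top X C = discrete_topology (Homeo X C)"
    if C: "compactin X C" "C \<subseteq> X closure_of (A - K n)" for C
  proof -
    \<comment> \<open>As \<open>A\<close> is closed, the closure of \<open>A - K n\<close> stays in
      \<open>A\<close>, so \<open>C\<close> is absorbed by a later stage.\<close>
    have "C \<subseteq> A"
      using C(2) closure_of_minimal[OF Diff_subset A] by blast
    then obtain m where m: "n \<le> m" "C \<subseteq> K m"
      using absorb[OF C(1)] by blast
    show ?thesis
      using Homeo_discrete_off_open_subgroup[OF X n[OF m(1)] m(2) C(2)] .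
  qed
  ultimately show ?thesis
    using K(2-4) by blast
qed blast

end
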